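(* Let $L$ be a first-order language, $\Gamma$ a set of unary $L$-types, and $M$ an $L$-structure omitting every type in $\Gamma$. The following are equivalent: (1) there are an infinite set $X\subseteq M$ and a choice function $\mathcal{C}$ on $\Gamma$ such that $M\models\neg\mathcal{C}(p)(m)$ for all $m\in X$ and $p\in\Gamma$; (2) there is a nonprincipal ultrafilter $U$ (on some index set $I$) such that the map $j:M\to\prod^\Gamma M/U$, $j(m)=[i\mapsto m]_U$, is not surjective.
   Context: A unary $L$-type is a set of $L$-formulas in one free variable $x$. A choice function on $\Gamma$ is a map $\mathcal{C}$ assigning to each $p\in\Gamma$ a formula $\mathcal{C}(p)\in p$. For an ultrafilter $U$ on $I$, $\prod^\Gamma M$ is the set of $f:I\to M$ for which there are $X_f\in U$ and a choice function $\mathcal{C}$ with $M\models\neg\mathcal{C}(p)(f(i))$ for all $p\in\Gamma$, $i\in X_f$; and $\prod^\Gamma M/U=\{[f]_U: f\in\prod^\Gamma M\}$, a subset of the ordinary ultrapower $M^I/U$. *)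

theory Defs
  imports Main "HOL-Library.FuncSet"
begin

section \<open>First-order languages, structures and satisfaction\<close>

text \<open>Constants are function symbols of arity 0.\<close>

record ('f, 'r) language =
  fun_syms :: "'f set"
  rel_syms :: "'r set"
  fun_arity :: "'f \<Rightarrow> nat"
  rel_arity :: "'r \<Rightarrow> nat"

datatype 'f trm = Var nat | Fn 'f "'f trm list"

datatype ('f, 'r) fm =
    Eq "'f trm" "'f trm"
  | Rel 'r "'f trm list"
  | Neg "('f, 'r) fm"
  | Conj "('f, 'r) fm" "('f, 'r) fm"
  | Disj "('f, 'r) fm" "('f, 'r) fm"
  | Imp "('f, 'r) fm" "('f, 'r) fm"
  | All nat "('f, 'r) fm"
  | Ex nat "('f, 'r) fm"

primrec wf_trm :: "('f, 'r) language \<Rightarrow> 'f trm \<Rightarrow> bool" where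
  "wf_trm L (Var n) \<longleftrightarrow> True"
| "wf_trm L (Fn f ts) \<longleftrightarrow>
     f \<in> fun_syms L \<and> length ts = fun_arity L f \<and> (\<forall>b \<in> set (map (wf_trm L) ts). b)"

primrec wf_fm :: "('f, 'r) language \<Rightarrow> ('f, 'r) fm \<Rightarrow> bool" where
  "wf_fm L (Eq s t) \<longleftrightarrow> wf_trm L s \<and> wf_trm L t"
| "wf_fm L (Rel r ts) \<longleftrightarrow>
     r \<in> rel_syms L \<and> length ts = rel_arity L r \<and> list_all (wf_trm L) ts"
| "wf_fm L (Neg \<phi>) \<longleftrightarrow> wf_fm L \<phi>"
| "wf_fm L (Conj \<phi> \<psi>) \<longleftrightarrow> wf_fm L \<phi> \<and> wf_fm L \<psi>"
| "wf_fm L (Disj \<phi> \<psi>) \<longleftrightarrow> wf_fm L \<phi> \<and> wf_fm L \<psi>"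
| "wf_fm L (Imp \<phi> \<psi>) \<longleftrightarrow> wf_fm L \<phi> \<and> wf_fm L \<psi>"
| "wf_fm L (All n \<phi>) \<longleftrightarrow> wf_fm L \<phi>"
| "wf_fm L (Ex n \<phi>) \<longleftrightarrow> wf_fm L \<phi>"

primrec fv_trm :: "'f trm \<Rightarrow> nat set" where
  "fv_trm (Var n) = {n}"
| "fv_trm (Fn f ts) = \<Union> (set (map fv_trm ts))"

primrec fv_fm :: "('f, 'r) fm \<Rightarrow> nat set" where
  "fv_fm (Eq s t) = fv_trm s \<union> fv_trm t"
| "fv_fm (Rel r ts) = \<Union> (set (map fv_trm ts))"
| "fv_fm (Neg \<phi>) = fv_fm \<phi>"
| "fv_fm (Conj \<phi> \<psi>) = fv_fm \<phi> \<union> fv_fm \<psi>"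
| "fv_fm (Disj \<phi> \<psi>) = fv_fm \<phi> \<union> fv_fm \<psi>"
| "fv_fm (Imp \<phi> \<psi>) = fv_fm \<phi> \<union> fv_fm \<psi>"
| "fv_fm (All n \<phi>) = fv_fm \<phi> - {n}"
| "fv_fm (Ex n \<phi>) = fv_fm \<phi> - {n}"

text \<open>Interpretations take argument lists; only lists of elements of the universe whose length
  is the arity matter.\<close>

record ('f, 'r, 'a) model =
  univ :: "'a set"
  fun_int :: "'f \<Rightarrow> 'a list \<Rightarrow> 'a"
  rel_int :: "'r \<Rightarrow> 'a list \<Rightarrow> bool"

definition is_structure :: "('f, 'r) language \<Rightarrow> ('f, 'r, 'a) model \<Rightarrow> bool" where
  "is_structure L M \<longleftrightarrow>
     univ M \<noteq> {} \<and>
     (\<forall>f\<in>fun_syms L. \<forall>xs. length xs = fun_arity L f \<and> set xs \<subseteq> univ M \<longrightarrow> fun_int M f xs \<in> univ M)"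

primrec eval_trm :: "('f, 'r, 'a) model \<Rightarrow> (nat \<Rightarrow> 'a) \<Rightarrow> 'f trm \<Rightarrow> 'a" where
  "eval_trm M v (Var n) = v n"
| "eval_trm M v (Fn f ts) = fun_int M f (map (eval_trm M v) ts)"

primrec sat :: "('f, 'r, 'a) model \<Rightarrow> (nat \<Rightarrow> 'a) \<Rightarrow> ('f, 'r) fm \<Rightarrow> bool" where
  "sat M v (Eq s t) \<longleftrightarrow> eval_trm M v s = eval_trm M v t"
| "sat M v (Rel r ts) \<longleftrightarrow> rel_int M r (map (eval_trm M v) ts)"
| "sat M v (Neg \<phi>) \<longleftrightarrow> \<not> sat M v \<phi>"
| "sat M v (Conj \<phi> \<psi>) \<longleftrightarrow> sat M v \<phi> \<and> sat M v \<psi>"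
| "sat M v (Disj \<phi> \<psi>) \<longleftrightarrow> sat M v \<phi> \<or> sat M v \<psi>"
| "sat M v (Imp \<phi> \<psi>) \<longleftrightarrow> (sat M v \<phi> \<longrightarrow> sat M v \<psi>)"
| "sat M v (All n \<phi>) \<longleftrightarrow> (\<forall>a\<in>univ M. sat M (v(n := a)) \<phi>)"
| "sat M v (Ex n \<phi>) \<longleftrightarrow> (\<exists>a\<in>univ M. sat M (v(n := a)) \<phi>)"


section \<open>Unary types\<close>

text \<open>The distinguished free variable \<open>x\<close> is variable 0.\<close>

definition unary_type :: "('f, 'r) language \<Rightarrow> ('f, 'r) fm set \<Rightarrow> bool" where
  "unary_type L p \<longleftrightarrow> (\<forall>\<phi>\<in>p. wf_fm L \<phi> \<and> fv_fm \<phi> \<subseteq> {0})"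

text \<open>\<open>M \<Turnstile> \<phi>(m)\<close>. The constant assignment is only a convenient total one sending variable 0 to
  \<open>m\<close>: the other variables are not free in the formulas of a unary type.\<close>

definition sat_at :: "('f, 'r, 'a) model \<Rightarrow> ('f, 'r) fm \<Rightarrow> 'a \<Rightarrow> bool" where
  "sat_at M \<phi> m \<longleftrightarrow> sat M (\<lambda>_. m) \<phi>"

definition realizes :: "('f, 'r, 'a) model \<Rightarrow> 'a \<Rightarrow> ('f, 'r) fm set \<Rightarrow> bool" where
  "realizes M m p \<longleftrightarrow> (\<forall>\<phi>\<in>p. sat_at M \<phi> m)"

definition omits :: "('f, 'r, 'a) model \<Rightarrow> ('f, 'r) fm set \<Rightarrow> bool" where
  "omits M p \<longleftrightarrow> \<not> (\<exists>m\<in>univ M. realizes M m p)"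

definition choice_function ::
    "('f, 'r) fm set set \<Rightarrow> (('f, 'r) fm set \<Rightarrow> ('f, 'r) fm) \<Rightarrow> bool" where
  "choice_function \<Gamma> C \<longleftrightarrow> (\<forall>p\<in>\<Gamma>. C p \<in> p)"


section \<open>Ultrafilters and ultrapowers\<close>

text \<open>An ultrafilter on the set \<open>I\<close> is a filter on the ambient type that contains \<open>I\<close>;
  \<open>X \<in> U\<close> reads \<open>\<forall>\<^sub>F i in U. i \<in> X\<close>. Index sets are subsets of a type \<open>'i\<close>, since types
  cannot be quantified existentially; \<open>'i\<close> must be infinite for a nonprincipal ultrafilter to exist.\<close>

definition ultrafilter_on :: "'i set \<Rightarrow> 'i filter \<Rightarrow> bool" where
  "ultrafilter_on I U \<longleftrightarrow>
     U \<le> principal I \<and> U \<noteq> bot \<and>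
     (\<forall>X\<subseteq>I. (\<forall>\<^sub>F i in U. i \<in> X) \<or> (\<forall>\<^sub>F i in U. i \<in> I - X))"

definition nonprincipal :: "'i filter \<Rightarrow> bool" where
  "nonprincipal U \<longleftrightarrow> \<not> (\<exists>S. U = principal S)"

definition upower_rel ::
    "('f, 'r, 'a) model \<Rightarrow> 'i set \<Rightarrow> 'i filter \<Rightarrow> (('i \<Rightarrow> 'a) \<times> ('i \<Rightarrow> 'a)) set" where
  "upower_rel M I U =
     {(f, g). f \<in> I \<rightarrow>\<^sub>E univ M \<and> g \<in> I \<rightarrow>\<^sub>E univ M \<and> (\<forall>\<^sub>F i in U. f i = g i)}"

definition upower_class ::
    "('f, 'r, 'a) model \<Rightarrow> 'i set \<Rightarrow> 'i filter \<Rightarrow> ('i \<Rightarrow> 'a) \<Rightarrow> ('i \<Rightarrow> 'a) set" where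
  "upower_class M I U f = upower_rel M I U `` {f}"

definition ultrapower ::
    "('f, 'r, 'a) model \<Rightarrow> 'i set \<Rightarrow> 'i filter \<Rightarrow> ('i \<Rightarrow> 'a) set set" where
  "ultrapower M I U = (I \<rightarrow>\<^sub>E univ M) // upower_rel M I U"

definition type_prod ::
    "('f, 'r) fm set set \<Rightarrow> ('f, 'r, 'a) model \<Rightarrow> 'i set \<Rightarrow> 'i filter \<Rightarrow> ('i \<Rightarrow> 'a) set" where
  "type_prod \<Gamma> M I U =
     {f \<in> I \<rightarrow>\<^sub>E univ M.
        \<exists>X C. X \<subseteq> I \<and> (\<forall>\<^sub>F i in U. i \<in> X) \<and> choice_function \<Gamma> C \<and>
              (\<forall>p\<in>\<Gamma>. \<forall>i\<in>X. sat_at M (Neg (C p)) (f i))}"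

definition type_upower ::
    "('f, 'r) fm set set \<Rightarrow> ('f, 'r, 'a) model \<Rightarrow> 'i set \<Rightarrow> 'i filter \<Rightarrow> ('i \<Rightarrow> 'a) set set" where
  "type_upower \<Gamma> M I U = upower_class M I U ` type_prod \<Gamma> M I U"

definition diag_map ::
    "('f, 'r, 'a) model \<Rightarrow> 'i set \<Rightarrow> 'i filter \<Rightarrow> 'a \<Rightarrow> ('i \<Rightarrow> 'a) set" where
  "diag_map M I U m = upower_class M I U (\<lambda>i\<in>I. m)"

lemma equiv_upower_rel: "equiv (I \<rightarrow>\<^sub>E univ M) (upower_rel M I U)"
  unfolding upower_rel_def
  by (rule equivI)
    (auto simp: refl_on_def sym_def trans_def eq_commute elim: eventually_elim2)

lemma type_upower_subset: "type_upower \<Gamma> M I U \<subseteq> ultrapower M I U"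
  by (auto simp: type_upower_def type_prod_def ultrapower_def upower_class_def quotient_def)

lemma diag_map_in_type_upower:
  assumes "ultrafilter_on I U" "\<forall>p\<in>\<Gamma>. omits M p" "m \<in> univ M"
  shows "diag_map M I U m \<in> type_upower \<Gamma> M I U"
proof -
  have "\<forall>p\<in>\<Gamma>. \<exists>\<phi>\<in>p. sat_at M (Neg \<phi>) m"
    using assms(2,3) by (auto simp: omits_def realizes_def sat_at_def)
  then obtain C where C: "\<forall>p\<in>\<Gamma>. C p \<in> p \<and> sat_at M (Neg (C p)) m"
    by metis
  have "\<forall>\<^sub>F i in U. i \<in> I"
    using assms(1) by (simp add: ultrafilter_on_def le_principal)
  with C assms(3) have "(\<lambda>i\<in>I. m) \<in> type_prod \<Gamma> M I U"
    by (auto simp: type_prod_def choice_function_def intro!: exI[of _ I] exI[of _ C])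
  then show ?thesis
    by (simp add: type_upower_def diag_map_def)
qed

end

theory Submission
  imports Defs
begin

text \<open>An element of the restricted ultrapower is constant modulo the ultrafilter as soon as it takes
  finitely many values on a large set. Hence an element off the diagonal takes infinitely many
  values on the large set witnessing membership, and these values form the required set.
  Conversely, an injection of a countable index set into the infinite set is not constant modulo any
  nonprincipal ultrafilter, while the given choice function works at every index.\<close>

text \<open>Zorn's lemma yields a minimal proper filter below \<open>F\<close>. Minimality forces it
  to decide every \<open>X\<close>: adding \<open>X\<close> to it either destroys properness or
  changes nothing.\<close>

lemma exists_ultrafilter_on_le:
  fixes F :: "'i filter"
  assumes "F \<noteq> bot" "F \<le> principal I"
  shows "\<exists>U\<le>F. ultrafilter_on I U"
proof -
  define A where "A = {G. G \<noteq> bot \<and> G \<le> F}"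
  have "\<exists>U\<in>A. \<forall>G\<in>A. G \<le> U \<longrightarrow> G = U"
  \<comment> \<open>The order is reversed, since a finer filter is a smaller one and ultrafilters
    are the minimal proper filters.\<close>
  proof (rule predicate_Zorn[where P = "(\<ge>)"])
    show "partial_order_on A (relation_of (\<ge>) A)"
      by (auto intro!: partial_order_on_relation_ofI)
    fix \<C> assume "\<C> \<in> Chains (relation_of (\<ge>) A)"
    then have \<C>: "\<C> \<subseteq> A" and chain: "\<And>G H. G \<in> \<C> \<Longrightarrow> H \<in> \<C> \<Longrightarrow> G \<le> H \<or> H \<le> G"
      by (auto simp: Chains_def relation_of_def)
    show "\<exists>G\<in>A. \<forall>H\<in>\<C>. G \<le> H"
    proof (cases "\<C> = {}")
      case True
      then show ?thesis
        using assms(1) by (auto simp: A_def)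
    next
      case False
      \<comment> \<open>A nonempty chain is directed downwards, so its infimum is just the union of
        its members. In particular \<open>False\<close> cannot become eventual in the limit.\<close>
      have "eventually P (Inf \<C>) \<longleftrightarrow> (\<exists>G\<in>\<C>. eventually P G)" for P
      proof (rule eventually_Inf_base[OF False])
        fix G H assume "G \<in> \<C>" "H \<in> \<C>"
        then show "\<exists>K\<in>\<C>. K \<le> inf G H"
          using chain[of G H] by auto
      qed
      then have "Inf \<C> \<noteq> bot"
        using \<C> by (auto simp: A_def trivial_limit_def)
      moreover have "Inf \<C> \<le> F"
        using False \<C> by (auto simp: A_def intro: Inf_lower2)
      ultimately show ?thesis
        by (auto simp: A_def intro: Inf_lower)
    qed
  qed
  then obtain U where U: "U \<noteq> bot" "U \<le> F"
    and min: "\<And>G. G \<noteq> bot \<Longrightarrow> G \<le> U \<Longrightarrow> G = U"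
    unfolding A_def by (metis (mono_tags, lifting) mem_Collect_eq order_trans)
  have UI: "U \<le> principal I"
    using U(2) assms(2) by (rule order_trans)
  have "(\<forall>\<^sub>F i in U. i \<in> X) \<or> (\<forall>\<^sub>F i in U. i \<in> I - X)" for X
  proof (cases "inf U (principal X) = bot")
    case True
    then have "\<forall>\<^sub>F i in U. i \<notin> X"
      by (simp add: trivial_limit_def eventually_inf_principal)
    moreover have "\<forall>\<^sub>F i in U. i \<in> I"
      using UI by (simp add: le_principal)
    ultimately show ?thesis
      by (auto intro: eventually_elim2)
  next
    case False
    then have "inf U (principal X) = U"
      by (simp add: min)
    then show ?thesis
      by (metis inf.cobounded2 le_principal)
  qed
  then show ?thesis
    using U UI by (auto simp: ultrafilter_on_def)
qed

text \<open>A filter below \<open>cofinite\<close> discards every single point, while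
  \<open>principal S\<close> keeps each point of \<open>S\<close>.\<close>

lemma nonprincipal_le_cofinite:
  assumes "U \<le> cofinite" "U \<noteq> bot"
  shows "nonprincipal U"
  unfolding nonprincipal_def
proof
  assume "\<exists>S. U = principal S"
  then obtain S where S: "U = principal S" ..
  with assms(2) obtain s where s: "s \<in> S"
    by (auto simp: principal_eq_bot_iff)
  have "\<forall>\<^sub>F i in cofinite. i \<noteq> s"
    by (simp add: eventually_cofinite)
  then have "\<forall>\<^sub>F i in U. i \<noteq> s"
    using assms(1) by (simp add: filter_leD)
  with s show False
    by (auto simp: S eventually_principal)
qed

text \<open>The trace of \<open>cofinite\<close> on an infinite \<open>I\<close> is proper, because
  no cofinite set misses \<open>I\<close>; it can therefore be refined to an ultrafilter.\<close>

lemma exists_ultrafilter_on_le_cofinite: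
  assumes "infinite I"
  shows "\<exists>U\<le>cofinite. ultrafilter_on I U"
proof -
  have "inf cofinite (principal I) \<noteq> bot"
    using assms by (simp add: trivial_limit_def eventually_inf_principal eventually_cofinite)
  then show ?thesis
    using exists_ultrafilter_on_le[of "inf cofinite (principal I)" I] by auto
qed

lemma ultrafilter_on_finite_image:
  assumes "ultrafilter_on I U" "\<forall>\<^sub>F i in U. i \<in> X" "finite (f ` X)"
  shows "\<exists>m\<in>f ` X. \<forall>\<^sub>F i in U. f i = m"
proof (rule ccontr)
  assume *: "\<not> ?thesis"
  have ultra: "(\<forall>\<^sub>F i in U. i \<in> Y) \<or> (\<forall>\<^sub>F i in U. i \<in> I - Y)" if "Y \<subseteq> I" for Y
    using assms(1) that by (simp add: ultrafilter_on_def)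
  have "\<forall>\<^sub>F i in U. f i \<noteq> m" if "m \<in> f ` X" for m
  proof -
    have "(\<forall>\<^sub>F i in U. i \<in> {i\<in>I. f i = m}) \<or> (\<forall>\<^sub>F i in U. i \<in> I - {i\<in>I. f i = m})"
      by (rule ultra) auto
    then show ?thesis
    proof
      assume "\<forall>\<^sub>F i in U. i \<in> {i\<in>I. f i = m}"
      then have "\<forall>\<^sub>F i in U. f i = m"
        by (rule eventually_mono) simp
      with * that show ?thesis
        by blast
    next
      assume "\<forall>\<^sub>F i in U. i \<in> I - {i\<in>I. f i = m}"
      then show ?thesis
        by (rule eventually_mono) simp
    qed
  qed
  then have "\<forall>\<^sub>F i in U. \<forall>m\<in>f ` X. f i \<noteq> m"
    by (intro eventually_ball_finite assms(3) ballI)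
  with assms(2) have "\<forall>\<^sub>F i in U. False"
    by eventually_elim auto
  with assms(1) show False
    by (simp add: ultrafilter_on_def)
qed

lemma upower_class_eq_iff:
  assumes "f \<in> I \<rightarrow>\<^sub>E univ M" "g \<in> I \<rightarrow>\<^sub>E univ M"
  shows "upower_class M I U f = upower_class M I U g \<longleftrightarrow> (\<forall>\<^sub>F i in U. f i = g i)"
  using eq_equiv_class_iff[OF equiv_upower_rel assms] assms
  by (simp add: upower_class_def upower_rel_def)

lemma upower_class_eq_diag_map_iff:
  assumes "ultrafilter_on I U" "f \<in> I \<rightarrow>\<^sub>E univ M" "m \<in> univ M"
  shows "upower_class M I U f = diag_map M I U m \<longleftrightarrow> (\<forall>\<^sub>F i in U. f i = m)"
proof -
  have I: "\<forall>\<^sub>F i in U. i \<in> I"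
    using assms(1) by (simp add: ultrafilter_on_def le_principal)
  have "upower_class M I U f = diag_map M I U m \<longleftrightarrow> (\<forall>\<^sub>F i in U. f i = (\<lambda>i\<in>I. m) i)"
    unfolding diag_map_def by (rule upower_class_eq_iff) (use assms in auto)
  also have "\<dots> \<longleftrightarrow> (\<forall>\<^sub>F i in U. f i = m)"
    by (rule eventually_cong[OF I]) simp
  finally show ?thesis .
qed

theorem theorem2p15:
  fixes L :: "('f, 'r) language"
    and \<Gamma> :: "('f, 'r) fm set set"
    and M :: "('f, 'r, 'a) model"
  assumes "\<forall>p\<in>\<Gamma>. unary_type L p"
    and "is_structure L M"
    and "\<forall>p\<in>\<Gamma>. omits M p"
    and "infinite (UNIV :: 'i set)"
  shows
    "(\<exists>X C. X \<subseteq> univ M \<and> infinite X \<and> choice_function \<Gamma> C \<and>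
        (\<forall>m\<in>X. \<forall>p\<in>\<Gamma>. sat_at M (Neg (C p)) m))
     \<longleftrightarrow>
     (\<exists>(I :: 'i set) U. ultrafilter_on I U \<and> nonprincipal U \<and>
        diag_map M I U ` univ M \<noteq> type_upower \<Gamma> M I U)"
    (is "?lhs \<longleftrightarrow> ?rhs")
proof
  assume ?lhs
  then obtain X C where X: "X \<subseteq> univ M" "infinite X" and C: "choice_function \<Gamma> C"
    and sat: "\<forall>m\<in>X. \<forall>p\<in>\<Gamma>. sat_at M (Neg (C p)) m"
    by blast
  \<comment> \<open>The cardinalities of \<open>'i\<close> and \<open>X\<close> are unrelated, but a
    countable index set embeds into both.\<close>
  obtain g :: "nat \<Rightarrow> 'i" where g: "inj g"
    using infinite_countable_subset[OF assms(4)] by blast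
  obtain h :: "nat \<Rightarrow> 'a" where h: "inj h" "range h \<subseteq> X"
    using infinite_countable_subset[OF X(2)] by blast
  define I where "I = range g"
  have "infinite I"
    using g by (simp add: I_def finite_image_iff)
  then obtain U where U: "U \<le> cofinite" "ultrafilter_on I U"
    using exists_ultrafilter_on_le_cofinite by blast
  have I: "\<forall>\<^sub>F i in U. i \<in> I" and U_ne: "U \<noteq> bot"
    using U(2) by (simp_all add: ultrafilter_on_def le_principal)
  \<comment> \<open>The index \<open>g n\<close> is sent to \<open>h n\<close>, which makes
    \<open>f\<close> injective on \<open>I\<close> with values in \<open>X\<close>.\<close>
  define f where "f = (\<lambda>i\<in>I. h (inv g i))"
  have fX: "f i \<in> X" if "i \<in> I" for i
    using that h(2) by (auto simp: f_def)
  then have f: "f \<in> I \<rightarrow>\<^sub>E univ M"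
    using X(1) by (auto simp: f_def)
  have inj: "inj_on f I"
    using g h(1) by (auto simp: inj_on_def f_def I_def)
  have "f \<in> type_prod \<Gamma> M I U"
    using f I C sat fX by (auto simp: type_prod_def intro!: exI[of _ I] exI[of _ C])
  moreover have "upower_class M I U f \<noteq> diag_map M I U m" if "m \<in> univ M" for m
  proof
    assume "upower_class M I U f = diag_map M I U m"
    then have eq: "\<forall>\<^sub>F i in U. f i = m"
      by (simp add: upower_class_eq_diag_map_iff[OF U(2) f that])
    \<comment> \<open>By injectivity a fibre has at most one point, and finite sets are negligible
      for a filter below \<open>cofinite\<close>.\<close>
    have "finite {i\<in>I. f i = m}"
    proof (rule inj_on_finite)
      show "inj_on f {i\<in>I. f i = m}"
        using inj by (rule inj_on_subset) auto
      show "f ` {i\<in>I. f i = m} \<subseteq> {m}"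
        by auto
    qed simp
    then have "\<forall>\<^sub>F i in cofinite. \<not> (i \<in> I \<and> f i = m)"
      by (simp add: eventually_cofinite)
    then have "\<forall>\<^sub>F i in U. \<not> (i \<in> I \<and> f i = m)"
      using U(1) by (rule filter_leD[rotated])
    with I eq have "\<forall>\<^sub>F i in U. False"
      by eventually_elim auto
    with U_ne show False
      by simp
  qed
  ultimately have "diag_map M I U ` univ M \<noteq> type_upower \<Gamma> M I U"
    unfolding type_upower_def by (metis image_iff)
  then show ?rhs
    using U U_ne nonprincipal_le_cofinite by blast
next
  assume ?rhs
  then obtain I :: "'i set" and U where U: "ultrafilter_on I U"
    and ne: "diag_map M I U ` univ M \<noteq> type_upower \<Gamma> M I U"
    by blast
  \<comment> \<open>As \<open>M\<close> omits every type in \<open>\<Gamma>\<close>, constant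
    functions always belong to the restricted product, so the two sets can differ only by a class
    off the diagonal.\<close>
  have "diag_map M I U ` univ M \<subseteq> type_upower \<Gamma> M I U"
    using diag_map_in_type_upower[OF U assms(3)] by blast
  with ne obtain f where "f \<in> type_prod \<Gamma> M I U"
    and off: "upower_class M I U f \<notin> diag_map M I U ` univ M"
    by (auto simp: type_upower_def)
  then obtain X C where f: "f \<in> I \<rightarrow>\<^sub>E univ M" and X: "X \<subseteq> I" "\<forall>\<^sub>F i in U. i \<in> X"
    and C: "choice_function \<Gamma> C" "\<forall>p\<in>\<Gamma>. \<forall>i\<in>X. sat_at M (Neg (C p)) (f i)"
    by (auto simp: type_prod_def)
  have sub: "f ` X \<subseteq> univ M"
    using f X(1) by auto
  \<comment> \<open>Otherwise \<open>f\<close> would be constant modulo \<open>U\<close> with a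
    value in \<open>univ M\<close>, which would place its class on the diagonal.\<close>
  have "infinite (f ` X)"
  proof
    assume "finite (f ` X)"
    then obtain m where "m \<in> f ` X" "\<forall>\<^sub>F i in U. f i = m"
      using ultrafilter_on_finite_image[OF U X(2)] by blast
    moreover from this sub have "m \<in> univ M"
      by blast
    ultimately have "upower_class M I U f = diag_map M I U m"
      by (simp only: upower_class_eq_diag_map_iff[OF U f])
    with off \<open>m \<in> univ M\<close> show False
      by blast
  qed
  with sub C show ?lhs
    by (intro exI[of _ "f ` X"] exI[of _ C]) auto
qed

end
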